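(* Let $$A=\begin{bmatrix}1&1\\1&1\end{bmatrix},\qquad B=\begin{bmatrix}1&1&0\\1&0&1\\1&0&1\end{bmatrix}.$$ The one-sided topological Markov shifts $(X_A,\sigma_A)$ and $(X_B,\sigma_B)$ are strongly continuous orbit equivalent, but not topologically conjugate.
   Context: $\mathbb{Z}_+$ is the set of nonnegative integers, $\mathbb{N}=\{1,2,\dots\}$. For an $N\times N$ matrix $A$ with entries in $\{0,1\}$, $X_A=\{(x_n)_{n\in\mathbb{N}}\in\{1,\dots,N\}^{\mathbb{N}} : A(x_n,x_{n+1})=1\ \forall n\}$ with the product topology and $\sigma_A((x_n)_n)=(x_{n+1})_n$. $(X_A,\sigma_A)$ and $(X_B,\sigma_B)$ are topologically conjugate if there is a homeomorphism $h:X_A\to X_B$ with $h\circ\sigma_A=\sigma_B\circ h$. A continuous orbit map $h:(X_A,\sigma_A)\to(X_B,\sigma_B)$ is a local homeomorphism $h:X_A\to X_B$ for which there are continuous $k_1,l_1:X_A\to\mathbb{Z}_+$ with $\sigma_B^{k_1(x)}(h(\sigma_A(x)))=\sigma_B^{l_1(x)}(h(x))$ for all $x\in X_A$. It is a strongly continuous orbit map if there is a continuous $b_1:X_A\to\mathbb{Z}$ with $l_1(x)-k_1(x)=1+b_1(x)-b_1(\sigma_A(x))$ for all $x\in X_A$ (the function $l_1-k_1$ does not depend on the choice of $k_1,l_1$). $(X_A,\sigma_A)$ and $(X_B,\sigma_B)$ are strongly continuous orbit equivalent if there is a homeomorphism $h:X_A\to X_B$ such that both $h$ and $h^{-1}$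 are strongly continuous orbit maps. *)

theory Defs
  imports "HOL-Analysis.Analysis"
begin

text \<open>
  The states of the shift are the elements of the finite index type \<open>'n\<close>, so the size of the
  matrix is \<open>CARD('n)\<close>. For the numeral types \<open>2\<close> and \<open>3\<close> the elements are named \<open>1, 2\<close> and
  \<open>1, 2, 3\<close>; there \<open>2 = 0\<close> and \<open>3 = 0\<close> respectively, and this is the indexing used by
  \<open>vector\<close>. A sequence \<open>(x\<^sub>n)\<close> with \<open>n \<ge> 1\<close> is represented by the function
  \<open>n \<mapsto> x (n - 1)\<close>, that is, positions are counted from 0.
\<close>

definition shift_space :: "nat^'n^'n \<Rightarrow> (nat \<Rightarrow> 'n::finite) set" where
  "shift_space A = {x. \<forall>n. A $ x n $ x (Suc n) = 1}"

definition shift :: "(nat \<Rightarrow> 'a) \<Rightarrow> nat \<Rightarrow> 'a" where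
  "shift x = (\<lambda>n. x (Suc n))"

definition shift_topology :: "nat^'n^'n \<Rightarrow> (nat \<Rightarrow> 'n::finite) topology" where
  "shift_topology A =
     subtopology (product_topology (\<lambda>_. discrete_topology UNIV) UNIV) (shift_space A)"

definition topologically_conjugate :: "nat^'n^'n \<Rightarrow> nat^'m^'m \<Rightarrow> bool" where
  "topologically_conjugate A B \<longleftrightarrow>
     (\<exists>h. homeomorphic_map (shift_topology A) (shift_topology B) h \<and>
          (\<forall>x\<in>shift_space A. h (shift x) = shift (h x)))"

definition local_homeomorphism :: "'a topology \<Rightarrow> 'b topology \<Rightarrow> ('a \<Rightarrow> 'b) \<Rightarrow> bool" where
  "local_homeomorphism X Y h \<longleftrightarrow>
     (\<forall>x\<in>topspace X. \<exists>U. openin X U \<and> x \<in> U \<and> openin Y (h ` U) \<and>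
        homeomorphic_map (subtopology X U) (subtopology Y (h ` U)) h)"

definition orbit_cocycles ::
  "nat^'n^'n \<Rightarrow> nat^'m^'m \<Rightarrow> ((nat \<Rightarrow> 'n::finite) \<Rightarrow> (nat \<Rightarrow> 'm::finite)) \<Rightarrow>
   ((nat \<Rightarrow> 'n) \<Rightarrow> nat) \<Rightarrow> ((nat \<Rightarrow> 'n) \<Rightarrow> nat) \<Rightarrow> bool" where
  "orbit_cocycles A B h k l \<longleftrightarrow>
     continuous_map (shift_topology A) (discrete_topology UNIV) k \<and>
     continuous_map (shift_topology A) (discrete_topology UNIV) l \<and>
     (\<forall>x\<in>shift_space A. (shift ^^ k x) (h (shift x)) = (shift ^^ l x) (h x))"

definition continuous_orbit_map ::
  "nat^'n^'n \<Rightarrow> nat^'m^'m \<Rightarrow> ((nat \<Rightarrow> 'n::finite) \<Rightarrow> (nat \<Rightarrow> 'm::finite)) \<Rightarrow> bool" where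
  "continuous_orbit_map A B h \<longleftrightarrow>
     local_homeomorphism (shift_topology A) (shift_topology B) h \<and>
     (\<exists>k l. orbit_cocycles A B h k l)"

text \<open>
  Only the difference \<open>l - k\<close> enters the coboundary condition, and for the shifts under
  consideration it does not depend on the choice of \<open>k\<close> and \<open>l\<close>; hence the existential
  quantifier over \<open>k\<close> and \<open>l\<close>.
\<close>

definition strongly_continuous_orbit_map ::
  "nat^'n^'n \<Rightarrow> nat^'m^'m \<Rightarrow> ((nat \<Rightarrow> 'n::finite) \<Rightarrow> (nat \<Rightarrow> 'm::finite)) \<Rightarrow> bool" where
  "strongly_continuous_orbit_map A B h \<longleftrightarrow>
     continuous_orbit_map A B h \<and>
     (\<exists>k l b. orbit_cocycles A B h k l \<and>
        continuous_map (shift_topology A) (discrete_topology UNIV) b \<and>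
        (\<forall>x\<in>shift_space A. int (l x) - int (k x) = 1 + b x - b (shift x)))"

definition strongly_continuous_orbit_equivalent :: "nat^'n^'n \<Rightarrow> nat^'m^'m \<Rightarrow> bool" where
  "strongly_continuous_orbit_equivalent A B \<longleftrightarrow>
     (\<exists>h g. homeomorphic_maps (shift_topology A) (shift_topology B) h g \<and>
        strongly_continuous_orbit_map A B h \<and> strongly_continuous_orbit_map B A g)"

end

theory Submission
  imports Defs
begin

text \<open>
  Every state of the graph of \<open>B\<close> has two outgoing edges. Label an edge by \<open>1\<close> if it ends in the
  state 1 and by \<open>2\<close> otherwise: then each state has one outgoing edge of either label, so a point of
  \<open>X\<^sub>B\<close> is the same as a pair of an initial state \<open>s\<close> and an arbitrary sequence \<open>w\<close> of labels, namely
  the run of a deterministic automaton on \<open>w\<close>. Moreover the state reached after two steps is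
  determined by the two labels read and does not depend on \<open>s\<close>; thus two points whose label
  sequences have a common tail (after \<open>p\<close> and \<open>q\<close> steps) agree themselves after two further steps
  (\<open>run_synchronises\<close>).

  The three states are matched with the complete prefix code \<open>u\<^sub>1 = 1\<close>, \<open>u\<^sub>2 = 21\<close>, \<open>u\<^sub>3 = 22\<close>: each
  \<open>x\<close> in the full 2-shift is \<open>u\<^sub>s w\<close> for unique \<open>s\<close> and \<open>w\<close>, and \<open>h (u\<^sub>s w) = (s, w)\<close> defines a
  homeomorphism \<open>h\<close> onto \<open>X\<^sub>B\<close>. Write \<open>L(x)\<close> for the length of the code word that \<open>x\<close> begins
  with. The labels of \<open>h x\<close> are a tail of \<open>x\<close>, with \<open>L(x)\<close> symbols removed, and those of
  \<open>h (\<sigma> x)\<close> are a tail of \<open>x\<close> with \<open>1 + L(\<sigma> x)\<close> symbols removed. Synchronisation therefore gives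
  cocycles with \<open>l - k = 1 + L(\<sigma> x) - L(x)\<close>, and \<open>b = -L\<close> is a solution of the coboundary
  equation. For the inverse map the roles of the two sides are exchanged, and \<open>b\<close> is the length of
  the code word belonging to the initial state.

  A conjugacy preserves the number of preimages of a point under the shift. In the full 2-shift
  this number is at most 2, because a point is determined by its first symbol and its image. The
  state 1 of \<open>B\<close> has three incoming edges, so a point of \<open>X\<^sub>B\<close> that starts with 1 has three
  preimages (\<open>shift_preimages_bound\<close>).
\<close>

section \<open>Shift spaces\<close>

lemma topspace_shift_topology [simp]: "topspace (shift_topology A) = shift_space A"
  by (simp add: shift_topology_def PiE_UNIV_domain)

lemma shift_in_shift_space: "x \<in> shift_space A \<Longrightarrow> shift x \<in> shift_space A"
  by (simp add: shift_space_def shift_def)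

lemma shift_const [simp]: "shift (\<lambda>_. c) = (\<lambda>_. c)"
  by (simp add: shift_def)

lemma funpow_shift: "(shift ^^ m) x n = x (m + n)"
  by (induction m arbitrary: n) (auto simp: shift_def)

text \<open>
  All the functions below read only finitely many symbols for each symbol of output, so these two
  criteria settle every continuity question: the points that agree with \<open>x\<close> in the first \<open>N\<close>
  positions form an open cylinder.
\<close>

lemma continuous_map_shift_topologyI:
  assumes "\<And>x x'. \<lbrakk>x \<in> shift_space A; x' \<in> shift_space A; \<forall>i<N. x i = x' i\<rbrakk> \<Longrightarrow> f x = f x'"
  shows "continuous_map (shift_topology A) (discrete_topology UNIV) f"
proof -
  have "openin (shift_topology A) {x \<in> shift_space A. f x \<in> U}" for U
  proof (subst openin_subopen, clarify)
    fix x assume x: "x \<in> shift_space A" "f x \<in> U"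
    define C where "C = (\<Pi>\<^sub>E i\<in>UNIV. if i < N then {x i} else UNIV)"
    have "openin (product_topology (\<lambda>_. discrete_topology UNIV) UNIV) C"
      unfolding C_def by (subst openin_PiE_gen) (auto intro: finite_subset[of _ "{..<N}"])
    then have "openin (shift_topology A) (C \<inter> shift_space A)"
      unfolding shift_topology_def openin_subtopology by blast
    moreover have "x \<in> C \<inter> shift_space A"
      using x by (auto simp: C_def)
    moreover have "C \<inter> shift_space A \<subseteq> {x \<in> shift_space A. f x \<in> U}"
    proof clarify
      fix x' assume x': "x' \<in> C" "x' \<in> shift_space A"
      have "\<forall>i<N. x i = x' i"
        using x'(1) by (fastforce simp: C_def PiE_iff split: if_splits)
      then show "f x' \<in> U" using assms[OF x(1) x'(2)] x(2) by simp
    qed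
    ultimately show "\<exists>T. openin (shift_topology A) T \<and> x \<in> T \<and> T \<subseteq> {x \<in> shift_space A. f x \<in> U}"
      by blast
  qed
  then show ?thesis by (simp add: continuous_map_def)
qed

lemma continuous_map_shift_topologiesI:
  assumes "\<And>x. x \<in> shift_space A \<Longrightarrow> h x \<in> shift_space B"
    and "\<And>n x x'. \<lbrakk>x \<in> shift_space A; x' \<in> shift_space A; \<forall>i<N n. x i = x' i\<rbrakk> \<Longrightarrow> h x n = h x' n"
  shows "continuous_map (shift_topology A) (shift_topology B) h"
proof -
  have "continuous_map (shift_topology A) (discrete_topology UNIV) (\<lambda>x. h x n)" for n
    by (rule continuous_map_shift_topologyI[where N = "N n"]) (rule assms(2))
  then have "continuous_map (shift_topology A) (product_topology (\<lambda>_. discrete_topology UNIV) UNIV) h"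
    by (simp add: continuous_map_componentwise_UNIV)
  then show ?thesis
    unfolding shift_topology_def[of B] using assms(1)
    by (auto simp: continuous_map_in_subtopology)
qed

lemma homeomorphic_map_imp_local_homeomorphism:
  assumes "homeomorphic_map X Y h"
  shows "local_homeomorphism X Y h"
proof -
  have "h ` topspace X = topspace Y" 
    using assms homeomorphic_imp_surjective_map by blast
  then show ?thesis
    unfolding local_homeomorphism_def using assms
    by (intro ballI exI[of _ "topspace X"]) auto
qed

lemma strongly_continuous_orbit_mapI:
  assumes "homeomorphic_map (shift_topology A) (shift_topology B) h"
    and "orbit_cocycles A B h k l"
    and "continuous_map (shift_topology A) (discrete_topology UNIV) b"
    and "\<And>x. x \<in> shift_space A \<Longrightarrow> int (l x) - int (k x) = 1 + b x - b (shift x)"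
  shows "strongly_continuous_orbit_map A B h"
  using assms homeomorphic_map_imp_local_homeomorphism
  unfolding strongly_continuous_orbit_map_def continuous_orbit_map_def by blast

section \<open>Sequences of the larger shift as runs of an automaton\<close>

definition next_state :: "3 \<Rightarrow> 2 \<Rightarrow> 3" where
  "next_state s a = (if a = 1 then 1 else if s = 1 then 2 else 3)"

text \<open>The sequence of states visited, initial state included, when the labels \<open>w\<close> are read.\<close>

primrec run :: "3 \<Rightarrow> (nat \<Rightarrow> 2) \<Rightarrow> nat \<Rightarrow> 3" where
  "run s w 0 = s"
| "run s w (Suc n) = next_state (run s w n) (w n)"

text \<open>
  The label of an edge is visible from its target: the edges into 1 are those labelled 1. For this
  reason labels can be recovered from states.
\<close>

definition labels :: "(nat \<Rightarrow> 3) \<Rightarrow> nat \<Rightarrow> 2" where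
  "labels y n = (if y (Suc n) = 1 then 1 else 2)"

lemma next_state_eq_1_iff [simp]: "next_state s a = 1 \<longleftrightarrow> a = 1"
  by (simp add: next_state_def)

lemma labels_run: "labels (run s w) = w"
proof
  fix n show "labels (run s w) n = w n"
    using exhaust_2[of "w n"] by (auto simp: labels_def)
qed

lemma shift_run: "shift (run s w) = run (next_state s (w 0)) (shift w)"
proof
  fix n show "shift (run s w) n = run (next_state s (w 0)) (shift w) n"
    by (induction n) (auto simp: shift_def)
qed

lemma shift_labels: "labels (shift y) = shift (labels y)"
  by (auto simp: labels_def shift_def)

lemma funpow_shift_run: "\<exists>t. (shift ^^ p) (run s w) = run t ((shift ^^ p) w)"
  by (induction p) (auto simp: shift_run)

text \<open>
  Label 1 always leads to state 1, and the labels 22 always lead to state 3, while 12 leads to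
  state 2. Hence two labels suffice to forget where a run has started.
\<close>

lemma run_synchronises:
  assumes "(shift ^^ p) w = (shift ^^ q) v"
  shows "(shift ^^ (p + 2)) (run s w) = (shift ^^ (q + 2)) (run t v)"
proof -
  have forget: "shift (shift (run s' u)) = shift (shift (run t' u))" for s' t' u
    by (simp add: shift_run next_state_def)
  obtain s' where s': "(shift ^^ p) (run s w) = run s' ((shift ^^ p) w)"
    using funpow_shift_run by blast
  obtain t' where t': "(shift ^^ q) (run t v) = run t' ((shift ^^ q) v)"
    using funpow_shift_run by blast
  show ?thesis using s' t' assms forget[of s' _ t'] by simp
qed

lemma run_cong: "\<forall>i<n. w i = v i \<Longrightarrow> run s w n = run s v n"
  by (induction n) auto

definition full_matrix :: "nat^2^2" where
  "full_matrix = vector [vector [1, 1], vector [1, 1]]"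

definition run_matrix :: "nat^3^3" where
  "run_matrix = vector [vector [1, 1, 0], vector [1, 0, 1], vector [1, 0, 1]]"

lemma shift_space_full_matrix [simp]: "shift_space full_matrix = UNIV"
proof -
  have "full_matrix $ i $ j = 1" for i j
    using exhaust_2[of i] exhaust_2[of j] by (auto simp: full_matrix_def)
  then show ?thesis by (simp add: shift_space_def)
qed

lemma run_matrix_eq_1_iff: "run_matrix $ s $ t = 1 \<longleftrightarrow> (\<exists>a. t = next_state s a)"
proof -
  have *: "(\<exists>a::2. P a) \<longleftrightarrow> P 1 \<or> P 2" for P by (metis exhaust_2)
  show ?thesis
    using exhaust_3[of s] exhaust_3[of t]
    by (auto simp: run_matrix_def next_state_def *)
qed

lemma shift_space_run_matrix:
  "shift_space run_matrix = {y. \<forall>n. \<exists>a. y (Suc n) = next_state (y n) a}"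
  unfolding shift_space_def run_matrix_eq_1_iff ..

lemma run_in_shift_space: "run s w \<in> shift_space run_matrix"
  by (auto simp: shift_space_run_matrix)

lemma run_labels:
  assumes "y \<in> shift_space run_matrix"
  shows "run (y 0) (labels y) = y"
proof
  fix n show "run (y 0) (labels y) n = y n"
  proof (induction n)
    case (Suc n)
    obtain a where "y (Suc n) = next_state (y n) a"
      using assms by (auto simp: shift_space_run_matrix)
    with Suc show ?case by (auto simp: labels_def next_state_def)
  qed simp
qed

section \<open>Recoding by a prefix code\<close>

text \<open>
  The code words \<open>1\<close>, \<open>21\<close>, \<open>22\<close> belong to the states 1, 2, 3. Any complete prefix code with three
  words would serve, since the orbit cocycles only depend on the lengths of the words.
\<close>

definition prefix_state :: "(nat \<Rightarrow> 2) \<Rightarrow> 3" where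
  "prefix_state x = (if x 0 = 1 then 1 else if x 1 = 1 then 2 else 3)"

definition code_length :: "3 \<Rightarrow> nat" where
  "code_length s = (if s = 1 then 1 else 2)"

definition prepend_code :: "3 \<Rightarrow> (nat \<Rightarrow> 2) \<Rightarrow> nat \<Rightarrow> 2" where
  "prepend_code s w = (if s = 1 then case_nat 1 w
     else case_nat 2 (case_nat (if s = 2 then 1 else 2) w))"

abbreviation prefix_length :: "(nat \<Rightarrow> 2) \<Rightarrow> nat" where
  "prefix_length x \<equiv> code_length (prefix_state x)"

definition to_runs :: "(nat \<Rightarrow> 2) \<Rightarrow> nat \<Rightarrow> 3" where
  "to_runs x = run (prefix_state x) ((shift ^^ prefix_length x) x)"

definition from_runs :: "(nat \<Rightarrow> 3) \<Rightarrow> nat \<Rightarrow> 2" where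
  "from_runs y = prepend_code (y 0) (labels y)"

lemma prefix_state_prepend_code [simp]: "prefix_state (prepend_code s w) = s"
  using exhaust_3[of s] by (auto simp: prefix_state_def prepend_code_def)

lemma funpow_shift_prepend_code: "(shift ^^ code_length s) (prepend_code s w) = w"
  by (auto simp: code_length_def prepend_code_def shift_def fun_eq_iff numeral_2_eq_2)

lemma prepend_code_prefix_state:
  "prepend_code (prefix_state x) ((shift ^^ prefix_length x) x) = x"
proof
  fix n 
  show "prepend_code (prefix_state x) ((shift ^^ prefix_length x) x) n = x n"
    using exhaust_2[of "x 0"] exhaust_2[of "x 1"]
    by (auto simp: prepend_code_def prefix_state_def code_length_def funpow_shift shift_def
        split: nat.split)
qed

lemma from_runs_to_runs: "from_runs (to_runs x) = x"
  by (simp add: from_runs_def to_runs_def labels_run prepend_code_prefix_state)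

lemma to_runs_from_runs: "y \<in> shift_space run_matrix \<Longrightarrow> to_runs (from_runs y) = y"
  by (simp add: from_runs_def to_runs_def funpow_shift_prepend_code run_labels)

lemma continuous_to_runs:
  "continuous_map (shift_topology full_matrix) (shift_topology run_matrix) to_runs"
proof (rule continuous_map_shift_topologiesI[where N = "\<lambda>n. n + 2"])
  fix n and x x' :: "nat \<Rightarrow> 2" assume eq: "\<forall>i<n + 2. x i = x' i"
  then have "prefix_state x = prefix_state x'" by (simp add: prefix_state_def)
  moreover from this have "\<forall>i<n. (shift ^^ prefix_length x) x i = (shift ^^ prefix_length x') x' i"
    using eq by (auto simp: funpow_shift code_length_def)
  ultimately show "to_runs x n = to_runs x' n"
    unfolding to_runs_def by (simp add: run_cong)
qed (simp add: to_runs_def run_in_shift_space)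

lemma continuous_from_runs:
  "continuous_map (shift_topology run_matrix) (shift_topology full_matrix) from_runs"
proof (rule continuous_map_shift_topologiesI[where N = Suc])
  fix n and y y' :: "nat \<Rightarrow> 3" assume "\<forall>i<Suc n. y i = y' i"
  then show "from_runs y n = from_runs y' n"
    by (auto simp: from_runs_def prepend_code_def labels_def split: nat.split)
qed simp

lemma homeomorphic_maps_to_runs:
  "homeomorphic_maps (shift_topology full_matrix) (shift_topology run_matrix) to_runs from_runs"
  by (simp add: homeomorphic_maps_def continuous_to_runs continuous_from_runs
      from_runs_to_runs to_runs_from_runs)

lemma strongly_continuous_orbit_map_to_runs:
  "strongly_continuous_orbit_map full_matrix run_matrix to_runs"
proof (rule strongly_continuous_orbit_mapI)
  let ?k = "\<lambda>x. prefix_length x + 2"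
  let ?l = "\<lambda>x. prefix_length (shift x) + 1 + 2"
  \<comment> \<open>Both sides of the orbit relation read the tail of \<open>x\<close> after
      \<open>prefix_length x + 1 + prefix_length (shift x)\<close> symbols; the additional 2 is the time that
      runs need to synchronise.\<close>
  let ?b = "\<lambda>x. - int (prefix_length x)"
  show "homeomorphic_map (shift_topology full_matrix) (shift_topology run_matrix) to_runs"
    using homeomorphic_maps_to_runs homeomorphic_maps_map by blast
  have "(shift ^^ ?k x) (to_runs (shift x)) = (shift ^^ ?l x) (to_runs x)" for x
    unfolding to_runs_def
    by (rule run_synchronises) (simp add: fun_eq_iff funpow_shift shift_def ac_simps)
  then show "orbit_cocycles full_matrix run_matrix to_runs ?k ?l"
    unfolding orbit_cocycles_def
    by (auto intro!: continuous_map_shift_topologyI[where N = 3] simp: prefix_state_def shift_def)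
  show "continuous_map (shift_topology full_matrix) (discrete_topology UNIV) ?b"
    by (rule continuous_map_shift_topologyI[where N = 2]) (simp add: prefix_state_def)
qed simp

lemma strongly_continuous_orbit_map_from_runs:
  "strongly_continuous_orbit_map run_matrix full_matrix from_runs"
proof (rule strongly_continuous_orbit_mapI)
  let ?k = "\<lambda>y. code_length (y 1)"
  let ?l = "\<lambda>y. Suc (code_length (y 0))"
  let ?b = "\<lambda>y. int (code_length (y 0))"
  \<comment> \<open>Removing the code word in front leaves the labels of \<open>shift y\<close> on the left of the orbit
      relation and, one shift later, the labels of \<open>y\<close> on the right.\<close>
  show "homeomorphic_map (shift_topology run_matrix) (shift_topology full_matrix) from_runs"
    using homeomorphic_maps_to_runs homeomorphic_maps_map homeomorphic_maps_sym by blast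
  have "(shift ^^ ?k y) (from_runs (shift y)) = (shift ^^ ?l y) (from_runs y)" for y
  proof -
    have "shift y 0 = y 1" by (simp add: shift_def)
    then show ?thesis by (simp add: from_runs_def funpow_shift_prepend_code shift_labels)
  qed
  then show "orbit_cocycles run_matrix full_matrix from_runs ?k ?l"
    unfolding orbit_cocycles_def
    by (auto intro!: continuous_map_shift_topologyI[where N = 2])
  show "continuous_map (shift_topology run_matrix) (discrete_topology UNIV) ?b"
    by (rule continuous_map_shift_topologyI[where N = 1]) simp
qed (simp add: shift_def)

section \<open>Counting preimages\<close>

text \<open>
  A conjugacy carries the preimages of a point bijectively to those of its image, and in the first
  shift the preimages of a point are told apart by their first symbol.
\<close>

lemma shift_preimages_bound:
  fixes A :: "nat^'n::finite^'n" and B :: "nat^'m::finite^'m"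
  assumes "topologically_conjugate A B"
    and S: "S \<subseteq> shift_space B" and eq: "\<And>y. y \<in> S \<Longrightarrow> shift y = z"
  shows "card S \<le> CARD('n)"
proof -
  obtain h where h: "homeomorphic_map (shift_topology A) (shift_topology B) h"
    and comm: "\<And>x. x \<in> shift_space A \<Longrightarrow> h (shift x) = shift (h x)"
    using assms(1) unfolding topologically_conjugate_def by blast
  have inj: "inj_on h (shift_space A)" and surj: "h ` shift_space A = shift_space B"
    using homeomorphic_imp_injective_map[OF h] homeomorphic_imp_surjective_map[OF h] by simp_all
  define T where "T = {x \<in> shift_space A. h x \<in> S}"
  have image: "h ` T = S" using S surj by (auto simp: T_def)
  have "inj_on (\<lambda>x. x 0) T"
  proof (rule inj_onI)
    fix x x' assume xx': "x \<in> T" "x' \<in> T" "x 0 = x' 0"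
    then have "h (shift x) = h (shift x')" using comm eq by (simp add: T_def)
    then have "shift x = shift x'"
      using inj xx' by (simp add: T_def inj_on_eq_iff shift_in_shift_space)
    then have "x n = x' n" for n
      using xx'(3) by (cases n) (auto simp: shift_def dest: fun_cong)
    then show "x = x'" by blast
  qed
  then have fin: "finite T" and "card T \<le> CARD('n)"
    using finite_imageD[of "\<lambda>x. x 0" T] card_inj_on_le[of "\<lambda>x. x 0" T UNIV] by simp_all
  then show ?thesis using card_image_le[OF fin, of h] image by simp
qed

lemma not_topologically_conjugate_full_run: "\<not> topologically_conjugate full_matrix run_matrix"
proof
  assume conj: "topologically_conjugate full_matrix run_matrix"
  \<comment> \<open>The points \<open>1111...\<close>, \<open>2111...\<close> and \<open>3111...\<close>, all mapped to \<open>1111...\<close> by the shift.\<close>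
  let ?S = "range (\<lambda>s. run s (\<lambda>_. 1))"
  have "inj (\<lambda>s. run s (\<lambda>_. 1))"
    by (rule injI) (drule fun_cong[where x = 0], simp)
  then have "card ?S = 3" by (simp add: card_image)
  moreover have "card ?S \<le> CARD(2)"
    by (rule shift_preimages_bound[OF conj, where z = "run 1 (\<lambda>_. 1)"])
      (auto simp: run_in_shift_space shift_run next_state_def)
  ultimately show False by simp
qed

theorem theorem1p5:
  fixes A :: "nat^2^2" and B :: "nat^3^3"
  assumes "A = vector [vector [1, 1],
                       vector [1, 1]]"
    and "B = vector [vector [1, 1, 0],
                     vector [1, 0, 1],
                     vector [1, 0, 1]]"
  shows "strongly_continuous_orbit_equivalent A B \<and> \<not> topologically_conjugate A B"
proof -
  have "A = full_matrix" "B = run_matrix"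
    using assms by (simp_all add: full_matrix_def run_matrix_def)
  then show ?thesis
    using homeomorphic_maps_to_runs strongly_continuous_orbit_map_to_runs
      strongly_continuous_orbit_map_from_runs not_topologically_conjugate_full_run
    unfolding strongly_continuous_orbit_equivalent_def by blast
qed

end
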